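(* Let $m$ be a positive even integer and let $S\subseteq\mathbb{R}^2$ be a finite set of points such that no two points of $S$ lie on a common line through the origin. Then the image $HV_m^2(S)\subset\mathbb{R}^{m+1}$ is neighborly.
   Context: The degree $m$ homogeneous Veronese map of the plane is $HV_m^2:\mathbb{R}^2\to\mathbb{R}^{m+1}$, mapping $(x,y)$ to the vector (in some fixed order) of all monomials of degree $m$ in $x,y$, i.e. $x^m,x^{m-1}y,\dots,y^m$. A polytope is $k$-neighborly if any set of $k$ or fewer of its vertices forms a face (is the vertex set of a face, the polytope itself being counted as a face). A polytope of dimension $d$ is neighborly if it is $\lfloor d/2\rfloor$-neighborly. A finite point set is $k$-neighborly (respectively neighborly) if it is the vertex set of a $k$-neighborly (respectively neighborly) polytope. *)

theory Defs
  imports "HOL-Analysis.Analysis"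
begin

(* The exponent function e on the index type 'n fixes the order of the monomials: e is meant to be
   a bijection from 'n onto {0..m}, so that CARD('n) = m + 1, and the coordinate i carries the
   monomial x^(m - e i) * y^(e i). *)
definition veronese :: "nat \<Rightarrow> ('n \<Rightarrow> nat) \<Rightarrow> real ^ 2 \<Rightarrow> real ^ 'n::finite"
  where "veronese m e p = (\<chi> i. (p $ 1) ^ (m - e i) * (p $ 2) ^ (e i))"

definition vertices :: "'a::euclidean_space set \<Rightarrow> 'a set"
  where "vertices P = {v. v extreme_point_of P}"

(* Both P itself and the empty set satisfy F face_of P. *)
definition k_neighborly :: "nat \<Rightarrow> 'a::euclidean_space set \<Rightarrow> bool"
  where "k_neighborly k P \<longleftrightarrow>
    polytope P \<and> (\<forall>T. T \<subseteq> vertices P \<and> card T \<le> k \<longrightarrow> (\<exists>F. F face_of P \<and> vertices F = T))"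

(* Integer division rounds down; for the empty polytope aff_dim is -1 and nat yields k = 0. *)
definition neighborly :: "'a::euclidean_space set \<Rightarrow> bool"
  where "neighborly P \<longleftrightarrow> k_neighborly (nat (aff_dim P div 2)) P"

definition neighborly_point_set :: "'a::euclidean_space set \<Rightarrow> bool"
  where "neighborly_point_set V \<longleftrightarrow> finite V \<and> (\<exists>P. neighborly P \<and> vertices P = V)"

definition line_through_origin :: "'a::euclidean_space set \<Rightarrow> bool"
  where "line_through_origin L \<longleftrightarrow> subspace L \<and> dim L = 1"

end

(* A nonempty set T of at most m/2 points of S is cut out of S by the form
   (x^2 + y^2)^(m/2 - card T) * (\<Prod>(s,t)\<in>T. (x t - y s)^2),
   which is homogeneous of degree m, nonnegative, and zero on S exactly at T. Such a form is a linear
   functional on the Veronese image, so its zero set supports a face with vertex set the image of T. *)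
theory Submission
  imports Defs
begin

text \<open>Forms are kept as functions with some coefficient sequence, so closure rules replace
  explicit expansion. The index is the exponent of the second coordinate, as \<open>e i\<close> is
  in \<open>veronese\<close>.\<close>

definition binary_form :: "nat \<Rightarrow> (real ^ 2 \<Rightarrow> real) \<Rightarrow> bool"
  where "binary_form k g \<longleftrightarrow>
    (\<exists>c. \<forall>p. g p = (\<Sum>i\<le>k. c i * ((p $ 1) ^ (k - i) * (p $ 2) ^ i)))"

lemma binary_form_const: "binary_form 0 (\<lambda>p. a)"
  unfolding binary_form_def by (rule exI[of _ "\<lambda>i. a"]) simp

lemma binary_form_add:
  assumes "binary_form k f" "binary_form k g"
  shows "binary_form k (\<lambda>p. f p + g p)"
proof -
  obtain c d where "\<And>p. f p = (\<Sum>i\<le>k. c i * ((p $ 1) ^ (k - i) * (p $ 2) ^ i))"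
    "\<And>p. g p = (\<Sum>i\<le>k. d i * ((p $ 1) ^ (k - i) * (p $ 2) ^ i))"
    using assms unfolding binary_form_def by blast
  then show ?thesis
    unfolding binary_form_def
    by (intro exI[of _ "\<lambda>i. c i + d i"]) (simp add: sum.distrib distrib_right)
qed

lemma binary_form_scale:
  assumes "binary_form k f"
  shows "binary_form k (\<lambda>p. a * f p)"
proof -
  obtain c where "\<And>p. f p = (\<Sum>i\<le>k. c i * ((p $ 1) ^ (k - i) * (p $ 2) ^ i))"
    using assms unfolding binary_form_def by blast
  then show ?thesis
    unfolding binary_form_def
    by (intro exI[of _ "\<lambda>i. a * c i"]) (simp add: sum_distrib_left mult.assoc)
qed

lemma binary_form_mult_fst:
  assumes "binary_form k f"
  shows "binary_form (Suc k) (\<lambda>p. p $ 1 * f p)"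
proof -
  obtain c where c: "\<And>p. f p = (\<Sum>i\<le>k. c i * ((p $ 1) ^ (k - i) * (p $ 2) ^ i))"
    using assms unfolding binary_form_def by blast
  \<comment> \<open>\<open>c\<close> is arbitrary beyond \<open>k\<close>, so the new top
    coefficient must be set to 0.\<close>
  have "p $ 1 * f p =
      (\<Sum>i\<le>Suc k. (if i \<le> k then c i else 0) * ((p $ 1) ^ (Suc k - i) * (p $ 2) ^ i))" for p
    by (auto simp: c sum_distrib_left Suc_diff_le intro!: sum.cong)
  then show ?thesis
    unfolding binary_form_def by (intro exI allI)
qed

lemma binary_form_mult_snd:
  assumes "binary_form k f"
  shows "binary_form (Suc k) (\<lambda>p. p $ 2 * f p)"
proof -
  obtain c where c: "\<And>p. f p = (\<Sum>i\<le>k. c i * ((p $ 1) ^ (k - i) * (p $ 2) ^ i))"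
    using assms unfolding binary_form_def by blast
  \<comment> \<open>Multiplication by \<open>p $ 2\<close> shifts the coefficients up by one,
    leaving 0 at index 0.\<close>
  have "p $ 2 * f p =
      (\<Sum>i\<le>Suc k. (case i of 0 \<Rightarrow> 0 | Suc j \<Rightarrow> c j) * ((p $ 1) ^ (Suc k - i) * (p $ 2) ^ i))" for p
    unfolding sum.atMost_Suc_shift by (auto simp: c sum_distrib_left intro!: sum.cong)
  then show ?thesis
    unfolding binary_form_def by (intro exI allI)
qed

lemma binary_form_mult_linear:
  assumes "binary_form k f"
  shows "binary_form (Suc k) (\<lambda>p. (a * p $ 1 + b * p $ 2) * f p)"
  using binary_form_add[OF binary_form_scale[OF binary_form_mult_fst[OF assms], of a]
      binary_form_scale[OF binary_form_mult_snd[OF assms], of b]]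
  by (simp add: algebra_simps)

text \<open>This factor pads the degree up to \<open>m\<close> without adding zeros away from the
  origin.\<close>

lemma binary_form_norm_power: "binary_form (2 * j) (\<lambda>p. ((p $ 1)\<^sup>2 + (p $ 2)\<^sup>2) ^ j)"
proof (induction j)
  case (Suc j)
  show ?case
    using binary_form_add[OF binary_form_mult_fst[OF binary_form_mult_fst[OF Suc]]
        binary_form_mult_snd[OF binary_form_mult_snd[OF Suc]]]
    by (simp add: algebra_simps power2_eq_square)
qed (simp add: binary_form_const)

text \<open>Each factor is the square of a linear form vanishing on the line through 0 and
  \<open>t\<close> (if \<open>t\<close> is nonzero), so each \<open>t\<close> costs two linear
  multiplications and raises the degree by 2.\<close>

lemma binary_form_prod_squares:
  assumes "finite T" "binary_form k f"
  shows "binary_form (2 * card T + k) (\<lambda>p. (\<Prod>t\<in>T. (p $ 1 * t $ 2 - p $ 2 * t $ 1)\<^sup>2) * f p)"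
  using assms(1)
proof induction
  case (insert t T)
  show ?case
    using binary_form_mult_linear[OF binary_form_mult_linear[OF insert.IH], of "t $ 2" "- t $ 1" "t $ 2" "- t $ 1"]
      insert.hyps
    by (simp add: power2_eq_square mult_ac)
qed (simp add: assms)

text \<open>The vector \<open>a\<close> lists the coefficients of the form in the order that
  \<open>e\<close> gives to the monomials.\<close>

lemma binary_form_eq_inner_veronese:
  fixes e :: "'n::finite \<Rightarrow> nat"
  assumes e: "bij_betw e UNIV {0..m}" and f: "binary_form m f"
  obtains a :: "real ^ 'n" where "\<And>p. a \<bullet> veronese m e p = f p"
proof -
  obtain c where c: "\<And>p. f p = (\<Sum>i\<le>m. c i * ((p $ 1) ^ (m - i) * (p $ 2) ^ i))"
    using f unfolding binary_form_def by blast
  have "(\<chi> i. c (e i)) \<bullet> veronese m e p = f p" for p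
    using sum.reindex_bij_betw[OF e, of "\<lambda>i. c i * ((p $ 1) ^ (m - i) * (p $ 2) ^ i)"]
    by (simp add: inner_vec_def veronese_def c atMost_atLeast0)
  then show thesis by (rule that)
qed

text \<open>A vanishing 2 by 2 determinant makes \<open>p\<close> and \<open>q\<close> linearly
  dependent. Contraposition turns the hypothesis on \<open>S\<close> into nonzero
  determinants.\<close>

lemma common_line_through_origin:
  fixes p q :: "real ^ 2"
  assumes "p \<noteq> q" and "p $ 1 * q $ 2 = p $ 2 * q $ 1"
  shows "\<exists>L. line_through_origin L \<and> p \<in> L \<and> q \<in> L"
proof -
  have line: "line_through_origin (span {r})" if "r \<noteq> 0" for r :: "real ^ 2"
    using that by (simp add: line_through_origin_def)
  show ?thesis
  proof (cases "p = 0")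
    case True
    then show ?thesis
      using line[of q] assms(1) by (metis insertI1 span_base span_zero)
  next
    case False
    then consider "p $ 1 \<noteq> 0" | "p $ 2 \<noteq> 0"
      by (metis exhaust_2 vec_eq_iff zero_index)
    then have "\<exists>k. q = k *\<^sub>R p"
    proof cases
      case 1
      then show ?thesis
        using assms(2)
        by (intro exI[of _ "q $ 1 / p $ 1"]) (auto simp: vec_eq_iff forall_2 field_simps)
    next
      case 2
      then show ?thesis
        using assms(2)
        by (intro exI[of _ "q $ 2 / p $ 2"]) (auto simp: vec_eq_iff forall_2 field_simps)
    qed
    then show ?thesis
      using line[OF False] by (metis insertI1 span_base span_scale)
  qed
qed

text \<open>The hyperplanes where the functionals vanish support the convex hull and cut out the
  faces. Positivity of \<open>k\<close> covers singletons, which makes every point of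
  \<open>V\<close> a vertex; the bound on \<open>DIM('a)\<close> makes \<open>k\<close> large enough
  whatever the dimension of the hull.\<close>

lemma neighborly_point_set_supportingI:
  fixes V :: "'a::euclidean_space set"
  assumes V: "finite V" and k: "k > 0" "DIM('a) div 2 \<le> k"
    and supp: "\<And>T. \<lbrakk>T \<subseteq> V; T \<noteq> {}; card T \<le> k\<rbrakk> \<Longrightarrow>
      \<exists>a. \<forall>v\<in>V. 0 \<le> a \<bullet> v \<and> (a \<bullet> v = 0 \<longleftrightarrow> v \<in> T)"
  shows "neighborly_point_set V"
proof -
  define P where "P = convex hull V"
  have verts_sub: "vertices P \<subseteq> V"
    unfolding P_def vertices_def using extreme_point_of_convex_hull by blast
  have face: "\<exists>F. F face_of P \<and> T \<subseteq> F \<and> vertices F = vertices P \<inter> T"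
    if T: "T \<subseteq> V" "T \<noteq> {}" "card T \<le> k" for T
  proof -
    obtain a where a: "\<And>v. v \<in> V \<Longrightarrow> 0 \<le> a \<bullet> v" "\<And>v. v \<in> V \<Longrightarrow> a \<bullet> v = 0 \<longleftrightarrow> v \<in> T"
      using supp[OF T] by blast
    define F where "F = P \<inter> {x. a \<bullet> x = 0}"
    have "P \<subseteq> {x. a \<bullet> x \<ge> 0}"
      unfolding P_def by (rule hull_minimal) (auto simp: a(1) convex_halfspace_ge)
    then have F: "F face_of P"
      unfolding F_def
      by (intro face_of_Int_supporting_hyperplane_ge) (auto simp: P_def convex_convex_hull)
    moreover have "T \<subseteq> F"
      using T a(2) by (auto simp: F_def P_def intro: hull_inc)
    \<comment> \<open>Extreme points of a face are the extreme points of \<open>P\<close> lying in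
      it; they belong to \<open>V\<close>, where \<open>a\<close> vanishes only on \<open>T\<close>.
      That all of \<open>T\<close> consists of vertices is not yet known.\<close>
    moreover have "vertices F = vertices P \<inter> T"
      using extreme_point_of_face[OF F] verts_sub a(2) T(1)
      by (auto simp: vertices_def F_def extreme_point_of_def)
    ultimately show ?thesis by blast
  qed
  \<comment> \<open>The face cut out by \<open>{v}\<close> is compact, convex and nonempty, so it
    has an extreme point, which can only be \<open>v\<close>.\<close>
  have "V \<subseteq> vertices P"
  proof
    fix v assume v: "v \<in> V"
    then obtain F where F: "F face_of P" "v \<in> F" "vertices F = vertices P \<inter> {v}"
      using face[of "{v}"] k by auto
    have "compact P"
      unfolding P_def using V by (simp add: finite_imp_compact_convex_hull)
    then have "compact F" "convex F"
      using F(1) by (auto simp: P_def convex_convex_hull intro: face_of_imp_compact face_of_imp_convex)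
    then obtain w where "w extreme_point_of F"
      using extreme_point_exists_convex[of F] F(2) by blast
    then show "v \<in> vertices P"
      using F(3) by (auto simp: vertices_def)
  qed
  with verts_sub have verts: "vertices P = V" by blast
  have "polytope P"
    unfolding P_def polytope_def using V by blast
  moreover have "\<exists>F. F face_of P \<and> vertices F = T"
    if T: "T \<subseteq> vertices P" "card T \<le> nat (aff_dim P div 2)" for T
  proof (cases "T = {}")
    case True
    \<comment> \<open>\<open>supp\<close> speaks only of nonempty sets; here the empty face
      serves.\<close>
    then show ?thesis
      by (intro exI[of _ "{}"]) (auto simp: vertices_def extreme_point_of_def)
  next
    case False
    have "card T \<le> k"
      using T(2) k(2) aff_dim_le_DIM[of P] by linarith
    then show ?thesis
      using face[of T] False T(1) verts by blast
  qed
  ultimately show ?thesis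
    using V verts unfolding neighborly_point_set_def neighborly_def k_neighborly_def by blast
qed

theorem theorem3p5:
  fixes m :: nat and e :: "'n::finite \<Rightarrow> nat" and S :: "(real ^ 2) set"
  assumes "m > 0" and "even m"
    and "bij_betw e UNIV {0..m}"
    and "finite S"
    and "\<And>p q. p \<in> S \<Longrightarrow> q \<in> S \<Longrightarrow> p \<noteq> q \<Longrightarrow>
           \<not> (\<exists>L. line_through_origin L \<and> p \<in> L \<and> q \<in> L)"
  shows "neighborly_point_set (veronese m e ` S)"
proof -
  have cross: "p $ 1 * q $ 2 \<noteq> p $ 2 * q $ 1" if "p \<in> S" "q \<in> S" "p \<noteq> q" for p q
    using assms(5)[OF that] common_line_through_origin[OF that(3)] by blast
  have supp: "\<exists>a. \<forall>p\<in>S. 0 \<le> a \<bullet> veronese m e p \<and> (a \<bullet> veronese m e p = 0 \<longleftrightarrow> p \<in> T)"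
    if T: "T \<subseteq> S" "T \<noteq> {}" "card T \<le> m div 2" for T
  proof -
    define g :: "real ^ 2 \<Rightarrow> real" where "g = (\<lambda>p. (p $ 1)\<^sup>2 + (p $ 2)\<^sup>2)"
    define h where "h = (\<lambda>p::real ^ 2. \<Prod>t\<in>T. (p $ 1 * t $ 2 - p $ 2 * t $ 1)\<^sup>2)"
    define f where "f = (\<lambda>p. h p * g p ^ (m div 2 - card T))"
    have fin: "finite T"
      using T(1) assms(4) finite_subset by blast
    \<comment> \<open>Evenness of \<open>m\<close> and the bound on \<open>card T\<close> make the
      division and the natural subtraction exact.\<close>
    have "2 * card T + 2 * (m div 2 - card T) = m"
      using T(3) assms(2) by auto
    then have "binary_form m f"
      using binary_form_prod_squares[OF fin binary_form_norm_power[of "m div 2 - card T"]]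
      by (simp add: f_def g_def h_def)
    then obtain a :: "real ^ 'n" where a: "\<And>p. a \<bullet> veronese m e p = f p"
      using binary_form_eq_inner_veronese[OF assms(3)] by blast
    have "0 \<le> f p \<and> (f p = 0 \<longleftrightarrow> p \<in> T)" if p: "p \<in> S" for p
    proof (cases "p \<in> T")
      case True
      then have "h p = 0"
        unfolding h_def using fin by (intro prod_zero) (auto intro!: bexI[of _ p])
      then show ?thesis
        using True by (simp add: f_def)
    next
      case False
      then have ne: "p $ 1 * t $ 2 \<noteq> p $ 2 * t $ 1" if "t \<in> T" for t
        using cross[OF p, of t] that T(1) by blast
      then have "h p > 0"
        unfolding h_def by (intro prod_pos) auto
      \<comment> \<open>Some \<open>t\<close> in the nonempty \<open>T\<close> has nonzero
        determinant with \<open>p\<close>, so \<open>p\<close> is not the origin.\<close>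
      moreover have "g p > 0"
        using ne T(2) unfolding g_def by (auto simp: sum_power2_gt_zero_iff)
      ultimately have "f p > 0"
        by (simp add: f_def)
      then show ?thesis
        using False by simp
    qed
    then show ?thesis
      by (intro exI[of _ a]) (simp add: a)
  qed
  \<comment> \<open>The functional for \<open>{p}\<close> separates \<open>p\<close> from the rest
    of \<open>S\<close>; singletons are allowed since \<open>m\<close> is at least 2. Injectivity
    lets subsets of the image be pulled back to \<open>S\<close> with the same cardinality.\<close>
  have inj: "inj_on (veronese m e) S"
  proof (rule inj_onI)
    fix p q assume pq: "p \<in> S" "q \<in> S" "veronese m e p = veronese m e q"
    have "card {p} \<le> m div 2"
      using assms(1,2) by auto
    then obtain a where "\<forall>r\<in>S. a \<bullet> veronese m e r = 0 \<longleftrightarrow> r \<in> {p}"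
      using supp[of "{p}"] pq by blast
    then show "p = q"
      using pq by (metis singleton_iff)
  qed
  \<comment> \<open>The ambient dimension \<open>m + 1\<close> is odd, so halving it rounds down to
    \<open>m div 2\<close>.\<close>
  have "CARD('n) = m + 1"
    using bij_betw_same_card[OF assms(3)] by simp
  then have "DIM(real ^ 'n) div 2 \<le> m div 2"
    using assms(2) by simp
  moreover have "m div 2 > 0"
    using assms(1,2) by auto
  moreover have "\<exists>a. \<forall>v\<in>veronese m e ` S. 0 \<le> a \<bullet> v \<and> (a \<bullet> v = 0 \<longleftrightarrow> v \<in> T)"
    if T: "T \<subseteq> veronese m e ` S" "T \<noteq> {}" "card T \<le> m div 2" for T
  proof -
    obtain U where U: "U \<subseteq> S" "T = veronese m e ` U"
      using T(1) subset_image_iff by metis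
    then have "card U \<le> m div 2" "U \<noteq> {}"
      using T card_image[OF inj_on_subset[OF inj U(1)]] by auto
    with supp[OF U(1)] show ?thesis
      using U inj_on_image_mem_iff[OF inj _ U(1)] by auto
  qed
  ultimately show ?thesis
    using assms(4) by (intro neighborly_point_set_supportingI[where k = "m div 2"]) auto
qed

end
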